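(* Let $G$ be a graph on $n$ vertices. Then $\operatorname{th}_{\gamma_P}(G)=n$ if and only if $G\simeq\overline{K}_n$ or $G\simeq K_2\,\dot\cup\,\overline{K}_{n-2}$.
   Context: All graphs are finite, simple, undirected, and have at least one vertex. $\overline{K}_m$ is the graph on $m$ vertices with no edges (when $m=0$ this term is omitted from a disjoint union, and a listed graph is disregarded if $m<0$); $\dot\cup$ is disjoint union; $\simeq$ is graph isomorphism. For $S\subseteq V(G)$, $N[S]$ is the set of vertices in $S$ or adjacent to a vertex of $S$. Given $G=(V,E)$ and $S\subseteq V$, initially (timestep $0$) the vertices of $S$ are colored; in timestep $1$ every vertex in $N[S]$ becomes colored; in each subsequent timestep, every vertex which is the only non-colored neighbor of some colored vertex becomes colored. $S$ is a power dominating set if all vertices eventually become colored, and then $\operatorname{ppt}(G;S)$ is the number of timesteps needed to color all of $G$ (so $\operatorname{ppt}(G;V)=0$). The power domination throttling number is $\operatorname{th}_{\gamma_P}(G)=\min\{|S|+\operatorname{ppt}(G;S): S \text{ a power dominating set of } G\}$. *)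

theory Defs
  imports "Graph_Theory.Digraph_Isomorphism"
begin

text \<open>
  A finite simple undirected graph is a \<^locale>\<open>graph\<close>: a finite loop-free digraph without parallel
  arcs whose set of arcs is symmetric, so that each edge is a pair of opposite arcs. This locale
  admits the graph without vertices.
\<close>

section \<open>Power domination throttling\<close>

definition closed_nbhd :: "('a, 'b) pre_digraph \<Rightarrow> 'a set \<Rightarrow> 'a set" where
  "closed_nbhd G S = {w \<in> verts G. w \<in> S \<or> (\<exists>v\<in>S. v \<rightarrow>\<^bsub>G\<^esub> w)}"

definition force_step :: "('a, 'b) pre_digraph \<Rightarrow> 'a set \<Rightarrow> 'a set" where
  "force_step G C = C \<union> {w. \<exists>v\<in>C. {u \<in> verts G. v \<rightarrow>\<^bsub>G\<^esub> u \<and> u \<notin> C} = {w}}"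

fun colored :: "('a, 'b) pre_digraph \<Rightarrow> 'a set \<Rightarrow> nat \<Rightarrow> 'a set" where
  "colored G S 0 = S"
| "colored G S (Suc 0) = closed_nbhd G S"
| "colored G S (Suc (Suc t)) = force_step G (colored G S (Suc t))"

definition power_dominating_set :: "('a, 'b) pre_digraph \<Rightarrow> 'a set \<Rightarrow> bool" where
  "power_dominating_set G S \<longleftrightarrow> S \<subseteq> verts G \<and> (\<exists>t. colored G S t = verts G)"

text \<open>Only meaningful if \<open>S\<close> is a power dominating set.\<close>

definition ppt :: "('a, 'b) pre_digraph \<Rightarrow> 'a set \<Rightarrow> nat" where
  "ppt G S = (LEAST t. colored G S t = verts G)"

definition pd_throttling :: "('a, 'b) pre_digraph \<Rightarrow> nat" where
  "pd_throttling G = Min {card S + ppt G S | S. power_dominating_set G S}"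

lemma power_dominating_set_verts: "power_dominating_set G (verts G)"
  unfolding power_dominating_set_def by (auto intro: exI[of _ 0])

lemma ppt_verts: "ppt G (verts G) = 0"
  unfolding ppt_def by (rule Least_eq_0) simp

lemma (in fin_digraph) finite_pd_values:
  "finite {card S + ppt G S | S. power_dominating_set G S}"
proof -
  have "{card S + ppt G S | S. power_dominating_set G S}
      \<subseteq> (\<lambda>S. card S + ppt G S) ` Pow (verts G)"
    by (auto simp: power_dominating_set_def)
  then show ?thesis
    by (rule finite_subset) simp
qed


section \<open>The extremal graphs\<close>

definition empty_graph :: "nat \<Rightarrow> (nat, nat \<times> nat) pre_digraph" where
  "empty_graph m = \<lparr>verts = {..<m}, arcs = {}, tail = fst, head = snd\<rparr>"

definition complete_graph :: "nat \<Rightarrow> (nat, nat \<times> nat) pre_digraph" where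
  "complete_graph m =
    \<lparr>verts = {..<m}, arcs = {(i, j). i < m \<and> j < m \<and> i \<noteq> j}, tail = fst, head = snd\<rparr>"

definition disjoint_union ::
    "('a, 'b) pre_digraph \<Rightarrow> ('c, 'd) pre_digraph \<Rightarrow> ('a + 'c, 'b + 'd) pre_digraph" where
  "disjoint_union G H =
    \<lparr>verts = verts G <+> verts H, arcs = arcs G <+> arcs H,
     tail = map_sum (tail G) (tail H), head = map_sum (head G) (head H)\<rparr>"

lemma graph_empty_graph: "graph (empty_graph m)"
  by unfold_locales (auto simp: empty_graph_def symmetric_conv)

lemma graph_complete_graph: "graph (complete_graph m)"
proof -
  have "finite {(i, j). i < m \<and> j < m \<and> i \<noteq> j}"
    by (rule finite_subset[of _ "{..<m} \<times> {..<m}"]) auto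
  then show ?thesis
    by unfold_locales (auto simp: complete_graph_def symmetric_conv arc_to_ends_def)
qed

lemma graph_disjoint_union:
  assumes "graph G" and "graph H"
  shows "graph (disjoint_union G H)"
proof -
  interpret G: graph G by fact
  interpret H: graph H by fact
  have "\<forall>e\<in>arcs G. \<exists>e'\<in>arcs G. tail G e = head G e' \<and> head G e = tail G e'"
    using G.sym_arcs by (simp add: symmetric_conv)
  moreover have "\<forall>e\<in>arcs H. \<exists>e'\<in>arcs H. tail H e = head H e' \<and> head H e = tail H e'"
    using H.sym_arcs by (simp add: symmetric_conv)
  ultimately show ?thesis
    by unfold_locales
      (auto simp: disjoint_union_def symmetric_conv arc_to_ends_def Plus_def ball_Un bex_Un
        dest: G.no_loops H.no_loops G.no_multi_arcs H.no_multi_arcs)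
qed

end

theory Submission
  imports Defs
begin

text \<open>
  Taking all vertices shows that the throttling number is at most \<open>n\<close>. If \<open>G\<close> has two distinct edges,
  they can be oriented so that their heads \<open>b \<noteq> d\<close> are distinct and neither tail is \<open>b\<close> or \<open>d\<close>; leaving
  out \<open>b\<close> and \<open>d\<close> then saves two vertices at the cost of one timestep. If \<open>G\<close> has at most one edge, at
  most one vertex is colored after timestep \<open>0\<close>, so nothing is saved.
\<close>

lemma (in graph) dominates_sym: "u \<rightarrow>\<^bsub>G\<^esub> v \<Longrightarrow> v \<rightarrow>\<^bsub>G\<^esub> u"
  by (rule arcs_ends_symmetric[OF sym_arcs])

lemma colored_ppt:
  assumes "power_dominating_set G S"
  shows "colored G S (ppt G S) = verts G"
  using assms LeastI_ex[of "\<lambda>t. colored G S t = verts G"]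
  by (simp add: power_dominating_set_def ppt_def)

lemma ppt_le: "colored G S t = verts G \<Longrightarrow> ppt G S \<le> t"
  unfolding ppt_def by (rule Least_le)

lemma (in fin_digraph) pd_throttling_le:
  assumes "power_dominating_set G S"
  shows "pd_throttling G \<le> card S + ppt G S"
  unfolding pd_throttling_def using assms by (intro Min_le finite_pd_values) auto

lemma (in fin_digraph) pd_throttling_attained:
  obtains S where "power_dominating_set G S" "pd_throttling G = card S + ppt G S"
proof -
  \<comment> \<open>\<open>Min\<close> is unspecified on the empty set; the full vertex set supplies
    a value.\<close>
  have "{card S + ppt G S | S. power_dominating_set G S} \<noteq> {}"
    using power_dominating_set_verts by blast
  from Min_in[OF finite_pd_values this] show thesis
    unfolding pd_throttling_def[symmetric] using that by blast
qed

lemma (in fin_digraph) pd_throttling_le_card: "pd_throttling G \<le> card (verts G)"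
  using pd_throttling_le[OF power_dominating_set_verts] by (simp add: ppt_verts)

text \<open>The tails \<open>a\<close> and \<open>c\<close> stay in \<open>?S\<close> and color
  \<open>b\<close> and \<open>d\<close> in timestep 1, so the cost is at most two vertices less and
  one timestep more than for the full vertex set.\<close>

lemma (in fin_digraph) pd_throttling_less_card:
  assumes "a \<rightarrow>\<^bsub>G\<^esub> b" "c \<rightarrow>\<^bsub>G\<^esub> d" "b \<noteq> d" "a \<notin> {b, d}" "c \<notin> {b, d}"
  shows "pd_throttling G < card (verts G)"
proof -
  let ?S = "verts G - {b, d}"
  have V: "a \<in> verts G" "b \<in> verts G" "c \<in> verts G" "d \<in> verts G"
    using assms(1,2) by (blast dest: adj_in_verts)+
  have "colored G ?S 1 = verts G"
    using assms V by (auto simp: closed_nbhd_def)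
  then have "power_dominating_set G ?S" "ppt G ?S \<le> 1"
    by (auto simp: power_dominating_set_def intro: ppt_le simp del: One_nat_def)
  moreover have "card ?S + 2 = card (verts G)"
    using V assms(3) card_mono[of "verts G" "{b, d}"] by (simp add: card_Diff_subset)
  ultimately show ?thesis using pd_throttling_le[of ?S] by linarith
qed

context graph begin

context
  assumes one_edge: "\<And>u v x y. u \<rightarrow>\<^bsub>G\<^esub> v \<Longrightarrow> x \<rightarrow>\<^bsub>G\<^esub> y \<Longrightarrow> {u, v} = {x, y}"
begin

text \<open>A vertex gained in timestep 1 is the end outside \<open>S\<close> of an edge whose other
  end lies in \<open>S\<close>. The only edge has at most one such end.\<close>

lemma closed_nbhd_Diff_unique:
  assumes "w \<in> closed_nbhd G S - S" "w' \<in> closed_nbhd G S - S"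
  shows "w = w'"
proof -
  obtain v v' where "v \<in> S" "v \<rightarrow>\<^bsub>G\<^esub> w" "v' \<in> S" "v' \<rightarrow>\<^bsub>G\<^esub> w'"
    using assms by (auto simp: closed_nbhd_def)
  with one_edge[of v w v' w'] assms show ?thesis by (auto simp: doubleton_eq_iff)
qed

text \<open>To force a new \<open>w\<close>, a vertex \<open>v\<close> would need one edge to
  \<open>w\<close> and, not being in \<open>S\<close> itself, a second edge to \<open>S\<close>.
  Hence propagation is over after timestep 1.\<close>

lemma force_step_closed_nbhd:
  assumes "S \<subseteq> verts G"
  shows "force_step G (closed_nbhd G S) = closed_nbhd G S"
proof -
  have False if v: "v \<in> closed_nbhd G S" "v \<rightarrow>\<^bsub>G\<^esub> w" and w: "w \<notin> closed_nbhd G S" for v w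
  proof -
    have V: "w \<in> verts G" using v(2) by (blast dest: adj_in_verts)
    then obtain s where s: "s \<in> S" "s \<rightarrow>\<^bsub>G\<^esub> v"
      using v w by (auto simp: closed_nbhd_def)
    \<comment> \<open>The edges from \<open>s\<close> to \<open>v\<close> and from \<open>v\<close>
      to \<open>w\<close> coincide, which puts \<open>w\<close> into \<open>S\<close>.\<close>
    with one_edge[of s v v w] v have "s = w"
      using adj_not_same by (auto simp: doubleton_eq_iff)
    with s w V show False by (auto simp: closed_nbhd_def)
  qed
  then show ?thesis unfolding force_step_def by blast
qed

lemma colored_Suc_eq_closed_nbhd: "S \<subseteq> verts G \<Longrightarrow> colored G S (Suc t) = closed_nbhd G S"
  by (induction t) (simp_all add: force_step_closed_nbhd)

text \<open>Either \<open>S\<close> is everything, or at least one timestep is spent and all of them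
  together gain at most one vertex.\<close>

lemma card_le_card_plus_ppt:
  assumes "power_dominating_set G S"
  shows "card (verts G) \<le> card S + ppt G S"
proof (cases "ppt G S")
  case 0
  then show ?thesis using colored_ppt[OF assms] by simp
next
  case (Suc t)
  have S: "S \<subseteq> verts G" using assms by (simp add: power_dominating_set_def)
  with Suc colored_ppt[OF assms] have "closed_nbhd G S = verts G"
    by (simp add: colored_Suc_eq_closed_nbhd)
  then have "card (verts G - S) \<le> Suc 0"
    using closed_nbhd_Diff_unique[of _ S] by (intro card_le_Suc0_iff_eq[THEN iffD2]) auto
  then show ?thesis
    using Suc S by (simp add: card_Diff_subset finite_subset)
qed

end

lemma pd_throttling_eq_card_iff:
  "pd_throttling G = card (verts G) \<longleftrightarrow>
    (\<forall>u v x y. u \<rightarrow>\<^bsub>G\<^esub> v \<longrightarrow> x \<rightarrow>\<^bsub>G\<^esub> y \<longrightarrow> {u, v} = {x, y})"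
proof
  assume eq: "pd_throttling G = card (verts G)"
  show "\<forall>u v x y. u \<rightarrow>\<^bsub>G\<^esub> v \<longrightarrow> x \<rightarrow>\<^bsub>G\<^esub> y \<longrightarrow> {u, v} = {x, y}"
  proof (intro allI impI, rule ccontr)
    fix u v x y assume e: "u \<rightarrow>\<^bsub>G\<^esub> v" "x \<rightarrow>\<^bsub>G\<^esub> y" and ne: "{u, v} \<noteq> {x, y}"
    have e': "v \<rightarrow>\<^bsub>G\<^esub> u" "y \<rightarrow>\<^bsub>G\<^esub> x" using e dominates_sym by auto
    have no: "\<not> (a \<rightarrow>\<^bsub>G\<^esub> b \<and> c \<rightarrow>\<^bsub>G\<^esub> d \<and> b \<noteq> d \<and> a \<notin> {b, d} \<and> c \<notin> {b, d})" for a b c d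
      using pd_throttling_less_card[of a b c d] eq by auto
    have "u \<noteq> v" "x \<noteq> y" using e adj_not_same by auto
    \<comment> \<open>Two edges that share a vertex must both be directed away from it, and it can
      be either end of each edge: hence the four orientations. For disjoint edges any orientation
      would do.\<close>
    with e e' no[of u v x y] no[of u v y x] no[of v u x y] no[of v u y x]
    have "u = x \<and> v = y \<or> u = y \<and> v = x"
      unfolding insert_iff empty_iff by metis
    with ne show False by auto
  qed
next
  assume *: "\<forall>u v x y. u \<rightarrow>\<^bsub>G\<^esub> v \<longrightarrow> x \<rightarrow>\<^bsub>G\<^esub> y \<longrightarrow> {u, v} = {x, y}"
  obtain S where S: "power_dominating_set G S" "pd_throttling G = card S + ppt G S"
    by (rule pd_throttling_attained)
  have "card (verts G) \<le> card S + ppt G S"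
    using * by (intro card_le_card_plus_ppt S(1)) blast
  with S(2) pd_throttling_le_card show "pd_throttling G = card (verts G)" by linarith
qed

end

text \<open>\<open>digraph_iso\<close> also asks for a map on arcs. Without parallel arcs an arc is
  determined by its ends, so the vertex map alone fixes the arc map.\<close>

lemma digraph_iso_iff_bij_betw:
  assumes "nomulti_digraph G" "nomulti_digraph H"
  shows "digraph_iso G H \<longleftrightarrow>
    (\<exists>f. bij_betw f (verts G) (verts H) \<and> map_prod f f ` arcs_ends G = arcs_ends H)"
proof -
  interpret G: nomulti_digraph G by fact
  interpret H: nomulti_digraph H by fact
  show ?thesis
  proof
    assume "digraph_iso G H"
    then obtain h where h: "G.digraph_isomorphism h" and H: "H = app_iso h G"
      by (auto simp: digraph_iso_def)
    have "bij_betw (iso_verts h) (verts G) (verts H)"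
      using G.digraph_isomorphism_inj_on_verts[OF h] by (simp add: H bij_betw_def)
    moreover have "map_prod (iso_verts h) (iso_verts h) ` arcs_ends G = arcs_ends H"
      unfolding H G.arcs_ends_app_iso_eq[OF h] map_prod_def ..
    ultimately show "\<exists>f. bij_betw f (verts G) (verts H) \<and> map_prod f f ` arcs_ends G = arcs_ends H"
      by blast
  next
    assume "\<exists>f. bij_betw f (verts G) (verts H) \<and> map_prod f f ` arcs_ends G = arcs_ends H"
    then obtain f where f: "bij_betw f (verts G) (verts H)"
      and ends: "map_prod f f ` arcs_ends G = arcs_ends H" by blast
    \<comment> \<open>The arc of \<open>H\<close> whose ends are the images under \<open>f\<close>
      of the ends of the given arc.\<close>
    define k where "k = the_inv_into (arcs H) (arc_to_ends H) \<circ> map_prod f f \<circ> arc_to_ends G"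
    have injf: "inj_on f (verts G)" using f by (rule bij_betw_imp_inj_on)
    have injG: "inj_on (map_prod f f) (arcs_ends G)"
      by (rule inj_on_subset[OF map_prod_inj_on[OF injf injf]]) (auto dest: G.adj_in_verts)
    have "bij_betw (arc_to_ends G) (arcs G) (arcs_ends G)"
      by (simp add: bij_betw_def G.inj_on_arc_to_ends arcs_ends_def)
    moreover have "bij_betw (map_prod f f) (arcs_ends G) (arcs_ends H)"
      using injG ends by (simp add: bij_betw_def)
    moreover have H: "bij_betw (arc_to_ends H) (arcs H) (arcs_ends H)"
      by (simp add: bij_betw_def H.inj_on_arc_to_ends arcs_ends_def)
    ultimately have k: "bij_betw k (arcs G) (arcs H)"
      unfolding k_def using bij_betw_the_inv_into[OF H] by (blast intro: bij_betw_trans)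
    have "arc_to_ends H (k e) = map_prod f f (arc_to_ends G e)" if "e \<in> arcs G" for e
    proof -
      have "map_prod f f (arc_to_ends G e) \<in> arc_to_ends H ` arcs H"
        using that ends unfolding arcs_ends_def by blast
      then show ?thesis
        unfolding k_def by (simp add: f_the_inv_into_f[OF H.inj_on_arc_to_ends])
    qed
    then have tail_head: "tail H (k e) = f (tail G e)" "head H (k e) = f (head G e)"
      if "e \<in> arcs G" for e
      using that by (simp_all add: arc_to_ends_def)
    \<comment> \<open>\<open>H = app_iso h G\<close> is an equality of records, so the head and tail
      functions must be those of \<open>H\<close> everywhere, not only on arcs.\<close>
    define h where "h = \<lparr>iso_verts = f, iso_arcs = k, iso_head = head H, iso_tail = tail H\<rparr>"
    have "G.digraph_isomorphism h"
      unfolding G.digraph_isomorphism_def h_def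
      using G.wf_digraph injf k tail_head by (auto simp: bij_betw_def)
    moreover have "H = app_iso h G"
      using f k by (simp add: h_def app_iso_def bij_betw_def)
    ultimately show "digraph_iso G H" unfolding digraph_iso_def by blast
  qed
qed

lemma verts_empty_graph [simp]: "verts (empty_graph m) = {..<m}"
  and arcs_ends_empty_graph [simp]: "arcs_ends (empty_graph m) = {}"
  by (simp_all add: empty_graph_def arcs_ends_def)

lemma verts_K2_union_empty:
  "verts (disjoint_union (complete_graph 2) (empty_graph m)) =
    {Inl 0, Inl 1} \<union> Inr ` {..<m}"
  by (auto simp: disjoint_union_def complete_graph_def less_2_cases_iff)

lemma arcs_ends_K2_union_empty:
  "arcs_ends (disjoint_union (complete_graph 2) (empty_graph m)) =
    {(Inl 0, Inl 1), (Inl 1, Inl 0)}"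
proof -
  have "{(i, j). i < (2::nat) \<and> j < 2 \<and> i \<noteq> j} = {(0, 1), (1, 0)}"
    by auto
  then show ?thesis
    by (simp add: arcs_ends_conv disjoint_union_def complete_graph_def empty_graph_def Plus_def)
qed

context graph begin

text \<open>Once there are no arcs to preserve, any enumeration of the vertices is an
  isomorphism.\<close>

lemma digraph_iso_empty_graph_iff:
  "digraph_iso G (empty_graph (card (verts G))) \<longleftrightarrow> arcs_ends G = {}"
proof -
  interpret E: graph "empty_graph (card (verts G))" by (rule graph_empty_graph)
  have "\<exists>f. bij_betw f (verts G) {..<card (verts G)}"
    by (rule finite_same_card_bij) auto
  then show ?thesis
    by (simp add: digraph_iso_iff_bij_betw[OF nomulti_digraph E.nomulti_digraph])
qed

text \<open>The edge is matched with the \<open>Inl\<close> vertices and the isolated vertices with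
  the \<open>Inr\<close> ones. The conjunct \<open>?large\<close> renders the convention that a
  graph of negative order is disregarded, since subtraction on naturals truncates at 0.\<close>

lemma digraph_iso_K2_union_empty_iff:
  "2 \<le> card (verts G) \<and>
    digraph_iso G (disjoint_union (complete_graph 2) (empty_graph (card (verts G) - 2))) \<longleftrightarrow>
    (\<exists>a b. arcs_ends G = {(a, b), (b, a)})"
  (is "?large \<and> digraph_iso G ?H \<longleftrightarrow> ?edge")
proof -
  interpret H: graph ?H
    by (intro graph_disjoint_union graph_complete_graph graph_empty_graph)
  note iso_iff = digraph_iso_iff_bij_betw[OF nomulti_digraph H.nomulti_digraph]
  show ?thesis
  proof
    assume "?large \<and> digraph_iso G ?H"
    then obtain f where f: "bij_betw f (verts G) (verts ?H)"
      and ends: "map_prod f f ` arcs_ends G = {(Inl 0, Inl 1), (Inl 1, Inl 0)}"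
      unfolding iso_iff arcs_ends_K2_union_empty by blast
    have inj: "u = v" if "f u = f v" "u \<in> verts G" "v \<in> verts G" for u v
      using bij_betw_imp_inj_on[OF f] that by (rule inj_onD)
    \<comment> \<open>The edge of \<open>G\<close> is found as a preimage of the edge of the
      complete graph; injectivity of \<open>f\<close> then identifies every other arc with it, up to
      direction.\<close>
    have "(Inl 0, Inl 1) \<in> map_prod f f ` arcs_ends G" using ends by simp
    then obtain a b where ab: "a \<rightarrow>\<^bsub>G\<^esub> b" "f a = Inl 0" "f b = Inl 1"
      by auto
    have V: "a \<in> verts G" "b \<in> verts G" using ab(1) by (blast dest: adj_in_verts)+
    have "(u, v) \<in> {(a, b), (b, a)}" if uv: "u \<rightarrow>\<^bsub>G\<^esub> v" for u v
    proof -
      have "(f u, f v) \<in> map_prod f f ` arcs_ends G" using uv by force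
      then have "f u = f a \<and> f v = f b \<or> f u = f b \<and> f v = f a"
        using ends ab by simp
      moreover have "u \<in> verts G" "v \<in> verts G" using uv by (blast dest: adj_in_verts)+
      ultimately show ?thesis using inj V by blast
    qed
    then have "arcs_ends G = {(a, b), (b, a)}"
      using ab(1) dominates_sym by auto
    then show ?edge by blast
  next
    assume ?edge
    then obtain a b where ends: "arcs_ends G = {(a, b), (b, a)}" by blast
    then have ab: "a \<rightarrow>\<^bsub>G\<^esub> b" by simp
    have V: "a \<in> verts G" "b \<in> verts G" and "a \<noteq> b"
      using ab by (blast dest: adj_in_verts adj_not_same)+
    then have card: "card (verts G - {a, b}) = card (verts G) - 2" and large: ?large
      using card_mono[of "verts G" "{a, b}"] by (simp_all add: card_Diff_subset)
    have "\<exists>g. bij_betw g (verts G - {a, b}) (Inr ` {..<card (verts G) - 2})"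
      by (rule finite_same_card_bij) (simp_all add: card card_image)
    then obtain g where
      g: "bij_betw g (verts G - {a, b}) (Inr ` {..<card (verts G) - 2} :: (nat + nat) set)" by blast
    \<comment> \<open>\<open>g\<close> enumerates the vertices off the edge, where \<open>f\<close>
      agrees with it; the two updates place the edge itself.\<close>
    define f where "f = g(a := Inl 0, b := Inl 1)"
    have "bij_betw f (verts G - {a, b}) (Inr ` {..<card (verts G) - 2})"
      using g by (rule bij_betw_cong[THEN iffD1, rotated]) (simp add: f_def)
    moreover have "bij_betw f {a, b} {Inl 0, Inl 1}"
      using \<open>a \<noteq> b\<close> by (auto simp: f_def bij_betw_def)
    ultimately have "bij_betw f ({a, b} \<union> (verts G - {a, b})) (verts ?H)"
      unfolding verts_K2_union_empty by (intro bij_betw_combine) auto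
    moreover have "{a, b} \<union> (verts G - {a, b}) = verts G" using V by blast
    moreover have "map_prod f f ` arcs_ends G = arcs_ends ?H"
      using \<open>a \<noteq> b\<close> by (simp add: ends arcs_ends_K2_union_empty f_def)
    ultimately show "?large \<and> digraph_iso G ?H" unfolding iso_iff using large by auto
  qed
qed

text \<open>Symmetry of the arcs is what makes a single edge contribute both ordered pairs. This
  form links the throttling criterion to the isomorphism criteria.\<close>

lemma at_most_one_edge_iff:
  "(\<forall>u v x y. u \<rightarrow>\<^bsub>G\<^esub> v \<longrightarrow> x \<rightarrow>\<^bsub>G\<^esub> y \<longrightarrow> {u, v} = {x, y}) \<longleftrightarrow>
    arcs_ends G = {} \<or> (\<exists>a b. arcs_ends G = {(a, b), (b, a)})"
proof
  assume *: "\<forall>u v x y. u \<rightarrow>\<^bsub>G\<^esub> v \<longrightarrow> x \<rightarrow>\<^bsub>G\<^esub> y \<longrightarrow> {u, v} = {x, y}"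
  show "arcs_ends G = {} \<or> (\<exists>a b. arcs_ends G = {(a, b), (b, a)})"
  proof (cases "arcs_ends G = {}")
    case False
    then obtain a b where ab: "a \<rightarrow>\<^bsub>G\<^esub> b" by auto
    have "(u, v) \<in> {(a, b), (b, a)}" if "u \<rightarrow>\<^bsub>G\<^esub> v" for u v
    proof -
      have "{u, v} = {a, b}" using * that ab by blast
      then show ?thesis by (auto simp: doubleton_eq_iff)
    qed
    then have "arcs_ends G = {(a, b), (b, a)}" using ab dominates_sym by auto
    then show ?thesis by blast
  qed simp
next
  assume "arcs_ends G = {} \<or> (\<exists>a b. arcs_ends G = {(a, b), (b, a)})"
  then show "\<forall>u v x y. u \<rightarrow>\<^bsub>G\<^esub> v \<longrightarrow> x \<rightarrow>\<^bsub>G\<^esub> y \<longrightarrow> {u, v} = {x, y}" by auto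
qed

end

theorem proposition16:
  fixes G :: "('a, 'b) pre_digraph" and n :: nat
  assumes "graph G" and "verts G \<noteq> {}" and "card (verts G) = n"
  shows "pd_throttling G = n \<longleftrightarrow>
    digraph_iso G (empty_graph n) \<or>
    n \<ge> 2 \<and> digraph_iso G (disjoint_union (complete_graph 2) (empty_graph (n - 2)))"
proof -
  interpret graph G by fact
  show ?thesis
    \<comment> \<open>Both sides become the same condition on \<open>arcs_ends G\<close>: no edge,
      or a single one.\<close>
    unfolding assms(3)[symmetric] pd_throttling_eq_card_iff at_most_one_edge_iff
      digraph_iso_empty_graph_iff digraph_iso_K2_union_empty_iff ..
qed

end
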